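(* Let $\rho$ be a smooth positive probability density on $\mathbb R^{n+m}$ and let $\Phi=\delta\mathrm D(\rho)$ be the $L^2$ first variation of $\mathrm D(\rho)=\int\rho\log\frac\rho\pi\,dx$, i.e. $\Phi=\log\frac\rho\pi+1$. Then $$\int\tilde\Gamma_2^z(\Phi,\Phi)\,\rho\,dx=\int\Gamma_2^{z,\pi}(\Phi,\Phi)\,\rho\,dx .$$
   Context: $n,m\ge1$, $a:\mathbb R^{n+m}\to\mathbb R^{(n+m)\times n}$ and $z:\mathbb R^{n+m}\to\mathbb R^{(n+m)\times m}$ are smooth matrix functions, $\pi$ a smooth positive probability density on $\mathbb R^{n+m}$; the columns of $a$ satisfy the strong H\"ormander condition. $Lf=\nabla\cdot(aa^{\mathsf T}\nabla f)+(\nabla\log\pi,aa^{\mathsf T}\nabla f)$, $L_zf=\nabla\cdot(zz^{\mathsf T}\nabla f)+(\nabla\log\pi,zz^{\mathsf T}\nabla f)$. $\Gamma_1(f,g)=\langle a^{\mathsf T}\nabla f,a^{\mathsf T}\nabla g\rangle$, $\Gamma_1^z(f,g)=\langle z^{\mathsf T}\nabla f,z^{\mathsf T}\nabla g\rangle$. $$\tilde\Gamma_2^z(f,f)=\tfrac12L\Gamma_1^z(f,f)-\Gamma_1(L_zf,f),$$ $$\Gamma_2^{z,\pi}(f,f)=\tfrac12L\Gamma_1^z(f,f)-\Gamma_1^z(Lf,f)+\tfrac1\pi\nabla\cdot\big(\pi zz^{\mathsf T}\langle\nabla f,\nabla(aa^{\mathsf T})\nabla f\rangle\big)-\tfrac1\pi\nabla\cdot\big(\pi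 aa^{\mathsf T}\langle\nabla f,\nabla(zz^{\mathsf T})\nabla f\rangle\big),$$ where $\langle\nabla f,\nabla(M)\nabla f\rangle$ denotes the vector with components $\langle\nabla f,(\partial_{x_p}M)\nabla f\rangle$, $p=1,\dots,n+m$. All functions are such that the integrals and integrations by parts on $\mathbb R^{n+m}$ make sense without boundary terms (the paper works formally in this respect). *)

theory Defs
  imports "HOL-Analysis.Analysis"
begin

primrec Ck :: "nat \<Rightarrow> ('a::euclidean_space \<Rightarrow> 'b::real_normed_vector) \<Rightarrow> bool" where
  "Ck 0 f \<longleftrightarrow> continuous_on UNIV f"
| "Ck (Suc k) f \<longleftrightarrow> (\<forall>x. f differentiable (at x)) \<and>
     (\<forall>v\<in>Basis. Ck k (\<lambda>x. frechet_derivative f (at x) v))"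

definition smooth :: "('a::euclidean_space \<Rightarrow> 'b::real_normed_vector) \<Rightarrow> bool" where
  "smooth f \<longleftrightarrow> (\<forall>k. Ck k f)"

definition smooth_positive_density :: "('a::euclidean_space \<Rightarrow> real) \<Rightarrow> bool" where
  "smooth_positive_density \<rho> \<longleftrightarrow> smooth \<rho> \<and> (\<forall>x. 0 < \<rho> x) \<and>
     integrable lborel \<rho> \<and> (\<integral>x. \<rho> x \<partial>lborel) = 1"

text \<open>The codomain is left general so that matrix functions can be differentiated entrywise.\<close>

definition partial :: "'d::finite \<Rightarrow> (real^'d \<Rightarrow> 'b::real_normed_vector) \<Rightarrow> real^'d \<Rightarrow> 'b" where
  "partial p f x = frechet_derivative f (at x) (axis p 1)"

definition grad :: "(real^'d \<Rightarrow> real) \<Rightarrow> real^'d \<Rightarrow> real^'d" where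
  "grad f x = (\<chi> p. partial p f x)"

definition divergence :: "(real^'d \<Rightarrow> real^'d) \<Rightarrow> real^'d \<Rightarrow> real" where
  "divergence F x = (\<Sum>p\<in>UNIV. partial p (\<lambda>y. F y $ p) x)"

definition lie_bracket :: "(real^'d \<Rightarrow> real^'d) \<Rightarrow> (real^'d \<Rightarrow> real^'d) \<Rightarrow> real^'d \<Rightarrow> real^'d" where
  "lie_bracket X Y x = frechet_derivative Y (at x) (X x) - frechet_derivative X (at x) (Y x)"

inductive_set iterated_brackets :: "(real^'d \<Rightarrow> real^'k^'d) \<Rightarrow> (real^'d \<Rightarrow> real^'d) set"
  for a :: "real^'d \<Rightarrow> real^'k^'d" where
  column: "(\<lambda>x. column j (a x)) \<in> iterated_brackets a"
| bracket: "\<lbrakk>X \<in> iterated_brackets a; Y \<in> iterated_brackets a\<rbrakk>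
            \<Longrightarrow> lie_bracket X Y \<in> iterated_brackets a"

text \<open>Strong form: only the columns of \<open>a\<close> generate the Lie algebra; no drift field is admitted.\<close>

definition strong_hormander :: "(real^'d \<Rightarrow> real^'k^'d) \<Rightarrow> bool" where
  "strong_hormander a \<longleftrightarrow> (\<forall>x. span ((\<lambda>X. X x) ` iterated_brackets a) = UNIV)"

definition mat_sq :: "(real^'d \<Rightarrow> real^'k^'d) \<Rightarrow> real^'d \<Rightarrow> real^'d^'d" where
  "mat_sq a x = a x ** transpose (a x)"

text \<open>\<open>generator a \<pi>\<close> is \<open>L\<close> and \<open>generator z \<pi>\<close> is \<open>L\<^sub>z\<close>; likewise \<open>Gamma1 a\<close>, \<open>Gamma1 z\<close>
  are \<open>\<Gamma>\<^sub>1\<close> and \<open>\<Gamma>\<^sub>1\<^sup>z\<close>.\<close>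

definition generator ::
  "(real^'d \<Rightarrow> real^'k^'d) \<Rightarrow> (real^'d \<Rightarrow> real) \<Rightarrow> (real^'d \<Rightarrow> real) \<Rightarrow> real^'d \<Rightarrow> real" where
  "generator a \<pi> f x =
     divergence (\<lambda>y. mat_sq a y *v grad f y) x
     + grad (\<lambda>y. ln (\<pi> y)) x \<bullet> (mat_sq a x *v grad f x)"

definition Gamma1 ::
  "(real^'d \<Rightarrow> real^'k^'d) \<Rightarrow> (real^'d \<Rightarrow> real) \<Rightarrow> (real^'d \<Rightarrow> real) \<Rightarrow> real^'d \<Rightarrow> real" where
  "Gamma1 a f g x = (transpose (a x) *v grad f x) \<bullet> (transpose (a x) *v grad g x)"

text \<open>The vector \<open>\<langle>\<nabla>f, \<nabla>(M) \<nabla>f\<rangle>\<close>.\<close>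

definition grad_mat_grad :: "(real^'d \<Rightarrow> real^'d^'d) \<Rightarrow> (real^'d \<Rightarrow> real) \<Rightarrow> real^'d \<Rightarrow> real^'d" where
  "grad_mat_grad M f x = (\<chi> p. grad f x \<bullet> (partial p M x *v grad f x))"

text \<open>The diagonal values \<open>\<Gamma>\<^sub>2\<^sup>z(f,f)\<close> (with tilde) and \<open>\<Gamma>\<^sub>2(f,f)\<close> (with superscripts
  \<open>z\<close> and \<open>\<pi>\<close>).\<close>

definition Gamma2_tilde ::
  "(real^'d \<Rightarrow> real^'k^'d) \<Rightarrow> (real^'d \<Rightarrow> real^'l^'d) \<Rightarrow> (real^'d \<Rightarrow> real)
   \<Rightarrow> (real^'d \<Rightarrow> real) \<Rightarrow> real^'d \<Rightarrow> real" where
  "Gamma2_tilde a z \<pi> f x =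
     1/2 * generator a \<pi> (Gamma1 z f f) x - Gamma1 a (generator z \<pi> f) f x"

definition Gamma2_z_pi ::
  "(real^'d \<Rightarrow> real^'k^'d) \<Rightarrow> (real^'d \<Rightarrow> real^'l^'d) \<Rightarrow> (real^'d \<Rightarrow> real)
   \<Rightarrow> (real^'d \<Rightarrow> real) \<Rightarrow> real^'d \<Rightarrow> real" where
  "Gamma2_z_pi a z \<pi> f x =
     1/2 * generator a \<pi> (Gamma1 z f f) x - Gamma1 z (generator a \<pi> f) f x
     + 1 / \<pi> x * divergence (\<lambda>y. \<pi> y *\<^sub>R (mat_sq z y *v grad_mat_grad (mat_sq a) f y)) x
     - 1 / \<pi> x * divergence (\<lambda>y. \<pi> y *\<^sub>R (mat_sq a y *v grad_mat_grad (mat_sq z) f y)) x"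

definition relative_entropy :: "('a::euclidean_space \<Rightarrow> real) \<Rightarrow> ('a \<Rightarrow> real) \<Rightarrow> real" where
  "relative_entropy \<pi> \<rho> = (\<integral>x. \<rho> x * ln (\<rho> x / \<pi> x) \<partial>lborel)"

text \<open>\<open>\<Phi>\<close> represents the first variation \<open>\<delta>F(\<rho>)\<close> in the \<open>L\<^sup>2\<close> pairing, tested against smooth
  compactly supported perturbations. These are not required to have mean zero, so the additive
  constant of \<open>\<Phi>\<close> is determined.\<close>

definition L2_first_variation ::
  "(('a::euclidean_space \<Rightarrow> real) \<Rightarrow> real) \<Rightarrow> ('a \<Rightarrow> real) \<Rightarrow> ('a \<Rightarrow> real) \<Rightarrow> bool" where
  "L2_first_variation F \<rho> \<Phi> \<longleftrightarrow>
     (\<forall>\<sigma>. smooth \<sigma> \<and> compact (closure {x. \<sigma> x \<noteq> 0}) \<longrightarrow>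
        integrable lborel (\<lambda>x. \<Phi> x * \<sigma> x) \<and>
        ((\<lambda>\<epsilon>. F (\<lambda>x. \<rho> x + \<epsilon> * \<sigma> x)) has_real_derivative (\<integral>x. \<Phi> x * \<sigma> x \<partial>lborel)) (at 0))"

text \<open>Integration by parts of \<open>g\<close> against the field \<open>F\<close> is meaningful on the whole space
  and produces no boundary term.\<close>

definition integrates_by_parts :: "(real^'d \<Rightarrow> real) \<Rightarrow> (real^'d \<Rightarrow> real^'d) \<Rightarrow> bool" where
  "integrates_by_parts g F \<longleftrightarrow>
     integrable lborel (\<lambda>x. g x * divergence F x) \<and>
     integrable lborel (\<lambda>x. grad g x \<bullet> F x) \<and>
     (\<integral>x. g x * divergence F x \<partial>lborel) = - (\<integral>x. grad g x \<bullet> F x \<partial>lborel)"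

end

theory Submission
  imports Defs
begin

text \<open>Write \<open>A = aa\<^sup>T\<close>, \<open>Z = zz\<^sup>T\<close>, and let \<open>G\<^sub>A\<close>, \<open>G\<^sub>Z\<close> be the fields \<open>\<langle>\<nabla>\<Phi>, \<nabla>A \<nabla>\<Phi>\<rangle>\<close>, \<open>\<langle>\<nabla>\<Phi>, \<nabla>Z \<nabla>\<Phi>\<rangle>\<close>.
  Since \<open>\<nabla>\<Phi> = \<nabla>log \<rho> - \<nabla>log \<pi>\<close>, one has \<open>\<nabla>\<cdot>(\<rho>A\<nabla>\<Phi>) = \<rho>(L\<Phi> + \<Gamma>\<^sub>1(\<Phi>,\<Phi>))\<close> and
  \<open>\<nabla>(\<rho>/\<pi>) = (\<rho>/\<pi>)\<nabla>\<Phi>\<close>. Integrating by parts, the product \<open>L\<Phi> L\<^sub>z\<Phi>\<close> drops out of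
  \<open>\<integral>\<Gamma>\<^sub>1\<^sup>z(L\<Phi>,\<Phi>)\<rho> - \<integral>\<Gamma>\<^sub>1(L\<^sub>z\<Phi>,\<Phi>)\<rho>\<close>, which leaves \<open>\<integral>(\<Gamma>\<^sub>1 L\<^sub>z\<Phi> - \<Gamma>\<^sub>1\<^sup>z L\<Phi>)\<rho>\<close>. A second
  integration by parts turns this into \<open>-\<integral>(\<nabla>\<Gamma>\<^sub>1 \<cdot> Z\<nabla>\<Phi> - \<nabla>\<Gamma>\<^sub>1\<^sup>z \<cdot> A\<nabla>\<Phi>)\<rho>\<close>, where the Hessian terms
  cancel by symmetry, so that only \<open>-\<integral>(G\<^sub>A \<cdot> Z\<nabla>\<Phi> - G\<^sub>Z \<cdot> A\<nabla>\<Phi>)\<rho>\<close> remains; the two divergence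
  terms of \<open>\<Gamma>\<^sub>2\<^sup>z\<close> contribute exactly the opposite after integrating them
  against \<open>\<rho>/\<pi>\<close>. The first variation formula follows from the quadratic bound on the Taylor remainder of \<open>t log (t/w)\<close>.\<close>

subsection \<open>Partial derivatives\<close>

lemma smooth_imp_differentiable: "smooth f \<Longrightarrow> f differentiable (at x)"
  unfolding smooth_def by (metis Ck.simps(2))

lemma smooth_frechet_derivative:
  "smooth f \<Longrightarrow> v \<in> Basis \<Longrightarrow> smooth (\<lambda>x. frechet_derivative f (at x) v)"
  unfolding smooth_def by (metis Ck.simps(2))

lemma smooth_partial: "smooth f \<Longrightarrow> smooth (partial p f)"
  unfolding partial_def by (rule smooth_frechet_derivative) (auto simp: axis_in_Basis_iff)

lemma smooth_imp_continuous_on: "smooth f \<Longrightarrow> continuous_on S f"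
  by (metis smooth_def Ck.simps(1) continuous_on_subset subset_UNIV)

lemma partial_eqI: "(f has_derivative f') (at x) \<Longrightarrow> partial p f x = f' (axis p 1)"
  unfolding partial_def using frechet_derivative_at by metis

text \<open>Chain rule along a coordinate line. It reduces \<open>partial\<close> to one-variable
  calculus, so that the mean value theorem applies.\<close>

lemma has_derivative_partial:
  fixes f :: "real^'d \<Rightarrow> 'b::real_normed_vector"
  assumes "f differentiable (at (x + t *\<^sub>R axis p 1))"
  shows "((\<lambda>s. f (x + s *\<^sub>R axis p 1)) has_derivative (\<lambda>h. h *\<^sub>R partial p f (x + t *\<^sub>R axis p 1))) (at t)"
proof -
  let ?f' = "frechet_derivative f (at (x + t *\<^sub>R axis p 1))"
  have f': "(f has_derivative ?f') (at (x + t *\<^sub>R axis p 1))"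
    using assms frechet_derivative_works by blast
  have "((\<lambda>s. f (x + s *\<^sub>R axis p 1)) has_derivative (\<lambda>h. ?f' (h *\<^sub>R axis p 1))) (at t)"
    by (rule has_derivative_compose[where g = f and s = UNIV]) (auto intro!: derivative_eq_intros f')
  then show ?thesis
    using linear_scale[OF linear_frechet_derivative[OF assms]] by (simp add: partial_def)
qed

text \<open>Serves as the common product rule for real multiplication, inner products and
  matrix-vector products.\<close>

lemma partial_bounded_bilinear:
  fixes bprod :: "'b::real_normed_vector \<Rightarrow> 'c::real_normed_vector \<Rightarrow> 'e::real_normed_vector"
  assumes "bounded_bilinear bprod" "f differentiable (at x)" "g differentiable (at x)"
  shows "partial p (\<lambda>y. bprod (f y) (g y)) x = bprod (f x) (partial p g x) + bprod (partial p f x) (g x)"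
  using partial_eqI[OF bounded_bilinear.FDERIV[OF assms(1) assms(2,3)[unfolded frechet_derivative_works]]]
  by (simp add: partial_def)

lemma differentiable_bounded_bilinear:
  fixes bprod :: "'b::real_normed_vector \<Rightarrow> 'c::real_normed_vector \<Rightarrow> 'e::real_normed_vector"
  assumes "bounded_bilinear bprod" "f differentiable (at x)" "g differentiable (at x)"
  shows "(\<lambda>y. bprod (f y) (g y)) differentiable (at x)"
  using bounded_bilinear.FDERIV[OF assms(1) assms(2,3)[unfolded frechet_derivative_works]]
  by (auto simp: differentiable_def)

lemma partial_vec_nth:
  "f differentiable (at x) \<Longrightarrow> partial p (\<lambda>y. f y $ i) x = partial p f x $ i"
  using bounded_linear.has_derivative[OF bounded_linear_vec_nth, of f "frechet_derivative f (at x)" "at x" i]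
  by (auto simp: frechet_derivative_works partial_def[of p f] intro: partial_eqI)

lemma differentiable_vec_nth:
  "f differentiable F \<Longrightarrow> (\<lambda>y. f y $ i) differentiable F"
  unfolding differentiable_def
  using bounded_linear.has_derivative[OF bounded_linear_vec_nth] by blast

lemma differentiable_vec_lambda:
  fixes f :: "'a::real_normed_vector \<Rightarrow> real^'d"
  assumes "\<And>i. (\<lambda>y. f y $ i) differentiable (at x)"
  shows "f differentiable (at x)"
proof -
  have f: "f = (\<lambda>y. \<Sum>i\<in>UNIV. f y $ i *\<^sub>R axis i 1)"
    by (auto simp: basis_expansion scalar_mult_eq_scaleR[symmetric])
  show ?thesis
    by (subst f) (intro derivative_intros assms ballI; simp)
qed

section \<open>Bilinearity of matrix products and the quadratic form of
  \<open>mat_sq\<close>\<close>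

lemma bounded_bilinear_matrix_vector_mult:
  "bounded_bilinear (\<lambda>(A::real^'n^'m) v. A *v v)"
  \<comment> \<open>In finite dimensions bilinear maps are bounded, so linearity in each argument
    suffices.\<close>
  by (subst bilinear_conv_bounded_bilinear[symmetric])
    (auto simp: bilinear_def linear_iff matrix_vector_right_distrib matrix_vector_mult_add_rdistrib
      scaleR_matrix_vector_assoc[symmetric] matrix_vector_mult_scaleR)

lemma bounded_bilinear_matrix_mult_transpose:
  "bounded_bilinear (\<lambda>(A::real^'n^'m) (B::real^'n^'k). A ** transpose B)"
  by (subst bilinear_conv_bounded_bilinear[symmetric])
    (auto simp: bilinear_def linear_iff matrix_matrix_mult_def transpose_def vec_eq_iff
      sum.distrib sum_distrib_left algebra_simps)

lemma differentiable_mat_sq: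
  "a differentiable (at x) \<Longrightarrow> mat_sq a differentiable (at x)"
  unfolding mat_sq_def[abs_def]
  by (rule differentiable_bounded_bilinear[OF bounded_bilinear_matrix_mult_transpose])

lemma inner_mat_sq: "v \<bullet> (mat_sq a x *v w) = (transpose (a x) *v v) \<bullet> (transpose (a x) *v w)"
  by (metis (no_types, lifting) dot_lmul_matrix mat_sq_def matrix_vector_mul_assoc transpose_matrix_vector)

lemma Gamma1_mat_sq: "Gamma1 a f g x = grad f x \<bullet> (mat_sq a x *v grad g x)"
  by (simp add: Gamma1_def inner_mat_sq)

section \<open>Symmetry of mixed second partial derivatives\<close>

lemma mixed_difference:
  fixes f :: "real^'d \<Rightarrow> real"
  assumes f: "\<And>x. f differentiable (at x)" and fp: "\<And>x. partial p f differentiable (at x)"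
    and h: "0 < h"
  obtains s t where "0 < s" "s < h" "0 < t" "t < h"
    "f (x + h *\<^sub>R axis p 1 + h *\<^sub>R axis q 1) - f (x + h *\<^sub>R axis p 1) - f (x + h *\<^sub>R axis q 1) + f x
       = h\<^sup>2 * partial q (partial p f) (x + s *\<^sub>R axis p 1 + t *\<^sub>R axis q 1)"
proof -
  let ?p = "axis p 1 :: real^'d" and ?q = "axis q 1 :: real^'d"
  \<comment> \<open>The mixed difference is \<open>\<phi> h - \<phi> 0\<close>. The mean value
    theorem is applied to it in direction \<open>p\<close>, then, with the resulting
    \<open>s\<close> fixed, to \<open>partial p f\<close> in direction \<open>q\<close>.\<close>
  define \<phi> where "\<phi> s = f (x + h *\<^sub>R ?q + s *\<^sub>R ?p) - f (x + s *\<^sub>R ?p)" for s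
  have d\<phi>: "(\<phi> has_real_derivative
      (partial p f (x + h *\<^sub>R ?q + s *\<^sub>R ?p) - partial p f (x + s *\<^sub>R ?p))) (at s)" for s
    unfolding \<phi>_def[abs_def] has_field_derivative_def
    by (rule has_derivative_eq_rhs[OF has_derivative_diff[OF has_derivative_partial[OF f] has_derivative_partial[OF f]]])
      (auto simp: algebra_simps)
  obtain s where s: "0 < s" "s < h"
    "\<phi> h - \<phi> 0 = (h - 0) * (partial p f (x + h *\<^sub>R ?q + s *\<^sub>R ?p) - partial p f (x + s *\<^sub>R ?p))"
    using MVT2[OF h d\<phi>] by blast
  let ?\<psi> = "\<lambda>t. partial p f (x + s *\<^sub>R ?p + t *\<^sub>R ?q)"
  have d\<psi>: "(?\<psi> has_real_derivative partial q (partial p f) (x + s *\<^sub>R ?p + t *\<^sub>R ?q)) (at t)" for t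
    unfolding has_field_derivative_def
    by (rule has_derivative_eq_rhs[OF has_derivative_partial[OF fp]]) (auto simp: algebra_simps)
  obtain t where t: "0 < t" "t < h"
    "?\<psi> h - ?\<psi> 0 = (h - 0) * partial q (partial p f) (x + s *\<^sub>R ?p + t *\<^sub>R ?q)"
    using MVT2[OF h d\<psi>] by blast
  show thesis
    by (rule that[OF s(1,2) t(1,2)]) (use s(3) t(3) in \<open>simp add: \<phi>_def power2_eq_square algebra_simps\<close>)
qed

text \<open>The mixed difference is symmetric in \<open>p\<close> and \<open>q\<close>. Evaluating
  it in both orders equates the two mixed derivatives at points near \<open>x\<close>, and
  continuity carries the equality to \<open>x\<close>.\<close>

lemma partial_commute:
  fixes f :: "real^'d \<Rightarrow> real"
  assumes f: "smooth f"
  shows "partial p (partial q f) x = partial q (partial p f) x"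
proof -
  let ?p = "axis p 1 :: real^'d" and ?q = "axis q 1 :: real^'d"
  note diff = smooth_imp_differentiable[OF f] smooth_imp_differentiable[OF smooth_partial[OF f]]
  \<comment> \<open>The two points may differ. Each is reached from \<open>x\<close> by two
    displacements shorter than \<open>h\<close>, whence the bound \<open>2 * h\<close>.\<close>
  have close: "\<exists>y z. dist y x \<le> 2 * h \<and> dist z x \<le> 2 * h \<and>
      partial p (partial q f) y = partial q (partial p f) z" if h: "0 < h" for h
  proof -
    obtain s t where st: "0 < s" "s < h" "0 < t" "t < h"
      "f (x + h *\<^sub>R ?p + h *\<^sub>R ?q) - f (x + h *\<^sub>R ?p) - f (x + h *\<^sub>R ?q) + f x
       = h\<^sup>2 * partial q (partial p f) (x + s *\<^sub>R ?p + t *\<^sub>R ?q)"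
      using mixed_difference[OF diff h] by blast
    obtain s' t' where st': "0 < s'" "s' < h" "0 < t'" "t' < h"
      "f (x + h *\<^sub>R ?q + h *\<^sub>R ?p) - f (x + h *\<^sub>R ?q) - f (x + h *\<^sub>R ?p) + f x
       = h\<^sup>2 * partial p (partial q f) (x + s' *\<^sub>R ?q + t' *\<^sub>R ?p)"
      using mixed_difference[OF diff h] by blast
    have "h\<^sup>2 * partial p (partial q f) (x + s' *\<^sub>R ?q + t' *\<^sub>R ?p)
        = h\<^sup>2 * partial q (partial p f) (x + s *\<^sub>R ?p + t *\<^sub>R ?q)"
      unfolding st(5)[symmetric] st'(5)[symmetric] by (simp add: add_ac)
    moreover have "dist (x + u *\<^sub>R axis i 1 + v *\<^sub>R axis j 1) x \<le> 2 * h"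
      if "0 < u" "u < h" "0 < v" "v < h" for u v and i j :: 'd
      using that norm_triangle_ineq[of "u *\<^sub>R axis i 1 :: real^'d" "v *\<^sub>R axis j 1"]
      by (simp add: dist_norm)
    ultimately show ?thesis
      using h st st' by (metis less_irrefl mult_left_cancel zero_less_power)
  qed
  have "\<exists>y z. dist y x \<le> 2 * (1 / real (Suc n)) \<and> dist z x \<le> 2 * (1 / real (Suc n)) \<and>
      partial p (partial q f) y = partial q (partial p f) z" for n
    by (rule close) simp
  then obtain Y Z where YZ: "\<And>n. dist (Y n) x \<le> 2 * (1 / real (Suc n))"
      "\<And>n. dist (Z n) x \<le> 2 * (1 / real (Suc n))"
      "\<And>n. partial p (partial q f) (Y n) = partial q (partial p f) (Z n)"
    by metis
  have lim: "W \<longlonglongrightarrow> x" if "\<And>n. dist (W n) x \<le> 2 * (1 / real (Suc n))" for W :: "nat \<Rightarrow> real^'d"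
  proof (subst tendsto_dist_iff, rule tendsto_sandwich[where f = "\<lambda>_. 0" and h = "\<lambda>n. 2 * (1 / real (Suc n))"])
    show "(\<lambda>n. 2 * (1 / real (Suc n))) \<longlonglongrightarrow> 0"
      using tendsto_mult_right_zero[OF LIMSEQ_inverse_real_of_nat] by (simp add: divide_inverse)
  qed (use that in auto)
  have cont: "isCont (partial i (partial j f)) x" for i j
    using smooth_imp_continuous_on[OF smooth_partial[OF smooth_partial[OF f]], of UNIV]
    by (simp add: continuous_on_eq_continuous_at)
  have "(\<lambda>n. partial p (partial q f) (Y n)) \<longlonglongrightarrow> partial p (partial q f) x"
    by (rule isCont_tendsto_compose[OF cont lim[OF YZ(1)]])
  moreover have "(\<lambda>n. partial p (partial q f) (Y n)) \<longlonglongrightarrow> partial q (partial p f) x"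
    unfolding YZ(3) by (rule isCont_tendsto_compose[OF cont lim[OF YZ(2)]])
  ultimately show ?thesis
    by (rule LIMSEQ_unique)
qed

section \<open>Product, quotient and logarithm rules for partial derivatives\<close>

lemma partial_mult:
  fixes f g :: "real^'d \<Rightarrow> real"
  assumes "f differentiable (at x)" "g differentiable (at x)"
  shows "partial p (\<lambda>y. f y * g y) x = f x * partial p g x + partial p f x * g x"
  by (rule partial_bounded_bilinear[OF bounded_bilinear_mult assms])

lemma partial_divide:
  fixes f g :: "real^'d \<Rightarrow> real"
  assumes "f differentiable (at x)" "g differentiable (at x)" "g x \<noteq> 0"
  shows "partial p (\<lambda>y. f y / g y) x = (partial p f x * g x - f x * partial p g x) / (g x * g x)"
  using partial_eqI[OF has_derivative_divide'[OF assms(1,2)[unfolded frechet_derivative_works] assms(3)]]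
  by (simp add: partial_def)

lemma partial_ln:
  fixes f :: "real^'d \<Rightarrow> real"
  assumes "f differentiable (at x)" "0 < f x"
  shows "partial p (\<lambda>y. ln (f y)) x = partial p f x / f x"
  using partial_eqI[OF has_derivative_ln[where g = f and x = x and s = UNIV,
      OF assms(2) assms(1)[unfolded frechet_derivative_works]]]
  by (simp add: partial_def divide_inverse)

lemma partial_diff:
  assumes "f differentiable (at x)" "g differentiable (at x)"
  shows "partial p (\<lambda>y. f y - g y) x = partial p f x - partial p g x"
  using partial_eqI[OF has_derivative_diff[OF assms[unfolded frechet_derivative_works]]]
  by (simp add: partial_def)

lemma partial_add_const:
  assumes "f differentiable (at x)"
  shows "partial p (\<lambda>y. f y + c) x = partial p f x"
  using partial_eqI[OF has_derivative_add_const[OF assms[unfolded frechet_derivative_works]]]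
  by (simp add: partial_def)

lemma differentiable_ln:
  fixes f :: "'a::real_normed_vector \<Rightarrow> real"
  assumes "f differentiable (at x)" "0 < f x"
  shows "(\<lambda>y. ln (f y)) differentiable (at x)"
  using has_derivative_ln[where g = f and x = x and s = UNIV, OF assms(2)] assms(1) unfolding differentiable_def by blast

subsection \<open>First variation of the relative entropy\<close>

lemma integrable_compact_support:
  fixes f :: "'a::euclidean_space \<Rightarrow> real"
  assumes "continuous_on UNIV f" "compact K" "\<And>x. x \<notin> K \<Longrightarrow> f x = 0"
  shows "integrable lborel f"
proof -
  have "(\<lambda>x. indicator K x *\<^sub>R f x) = f"
    using assms(3) by (auto simp: fun_eq_iff indicator_def)
  then show ?thesis
    using borel_integrable_compact[OF assms(2) continuous_on_subset[OF assms(1) subset_UNIV]] by simp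
qed

lemma bounded_compact_support:
  fixes f :: "'a::topological_space \<Rightarrow> real"
  assumes "continuous_on UNIV f" "compact K" "\<And>x. x \<notin> K \<Longrightarrow> f x = 0"
  obtains M where "0 < M" "\<And>x. \<bar>f x\<bar> \<le> M"
proof -
  have "bounded (f ` K)"
    using assms by (metis compact_continuous_image compact_imp_bounded continuous_on_subset subset_UNIV)
  then obtain M where M: "0 < M" "\<And>x. x \<in> K \<Longrightarrow> \<bar>f x\<bar> \<le> M"
    unfolding bounded_pos by auto
  show thesis
    using that[OF M(1)] M assms(3) by (metis abs_zero less_eq_real_def)
qed

text \<open>The remainder equals \<open>t * ln (t / s) - (t - s)\<close>; both bounds are \<open>ln u \<le> u - 1\<close>.\<close>

lemma entropy_remainder_bounds:
  fixes s t w :: real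
  assumes "0 < s" "0 < t" "0 < w"
  defines "R \<equiv> t * ln (t / w) - s * ln (s / w) - (t - s) * (ln (s / w) + 1)"
  shows "0 \<le> R" "R \<le> (t - s)\<^sup>2 / s"
proof -
  have R: "R = t * ln (t / s) - (t - s)"
    using assms by (simp add: R_def ln_div algebra_simps)
  have "ln (s / t) \<le> s / t - 1"
    using assms by (intro ln_le_minus_one) simp
  then have "t * ln (s / t) \<le> t * (s / t - 1)"
    using assms by (simp add: mult_left_mono)
  then show "0 \<le> R"
    using assms by (simp add: R ln_div algebra_simps)
  have "ln (t / s) \<le> t / s - 1"
    using assms by (intro ln_le_minus_one) simp
  then have "t * ln (t / s) \<le> t * (t / s - 1)"
    using assms by (simp add: mult_left_mono)
  also have "\<dots> - (t - s) = (t - s)\<^sup>2 / s"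
    using assms by (simp add: field_simps power2_eq_square)
  finally show "R \<le> (t - s)\<^sup>2 / s"
    by (simp add: R)
qed

text \<open>Dividing the bound by \<open>h\<close> leaves an error of at most
  \<open>\<bar>h\<bar> * C\<close> in the difference quotient.\<close>

lemma has_real_derivative_quadratic_remainder:
  fixes F :: "real \<Rightarrow> real"
  assumes "0 < \<delta>" "\<And>h. \<bar>h\<bar> < \<delta> \<Longrightarrow> \<bar>F h - F 0 - h * D\<bar> \<le> h\<^sup>2 * C"
  shows "(F has_real_derivative D) (at 0)"
proof -
  have "((\<lambda>h. (F h - F 0) / h - D) \<longlongrightarrow> 0) (at 0)"
  proof (rule Lim_null_comparison)
    show "\<forall>\<^sub>F h in at 0. norm ((F h - F 0) / h - D) \<le> \<bar>h\<bar> * C"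
      unfolding eventually_at
    proof (intro exI[of _ \<delta>] conjI ballI impI)
      fix h :: real assume h: "h \<noteq> 0 \<and> dist h 0 < \<delta>"
      have "\<bar>h\<bar> * \<bar>(F h - F 0) / h - D\<bar> = \<bar>F h - F 0 - h * D\<bar>"
        using h by (subst abs_mult[symmetric], intro arg_cong[where f = abs]) (simp add: field_simps)
      also have "\<dots> \<le> \<bar>h\<bar> * (\<bar>h\<bar> * C)"
        using assms(2)[of h] h by (simp add: power2_eq_square flip: mult.assoc)
      finally show "norm ((F h - F 0) / h - D) \<le> \<bar>h\<bar> * C"
        using h by simp
    qed (fact assms(1))
    show "((\<lambda>h. \<bar>h\<bar> * C) \<longlongrightarrow> 0) (at 0)"
      by (auto intro!: tendsto_eq_intros)
  qed
  then show ?thesis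
    by (simp add: DERIV_def LIM_zero_iff)
qed

lemma L2_first_variation_relative_entropy:
  fixes \<pi> \<rho> :: "'a::euclidean_space \<Rightarrow> real"
  assumes cont: "continuous_on UNIV \<rho>" "continuous_on UNIV \<pi>"
    and pos: "\<And>x. 0 < \<rho> x" "\<And>x. 0 < \<pi> x"
    and fin: "integrable lborel (\<lambda>x. \<rho> x * ln (\<rho> x / \<pi> x))"
  shows "L2_first_variation (relative_entropy \<pi>) \<rho> (\<lambda>x. ln (\<rho> x / \<pi> x) + 1)"
  unfolding L2_first_variation_def
proof (intro allI impI conjI; elim conjE)
  fix \<sigma> :: "'a \<Rightarrow> real"
  assume \<sigma>: "smooth \<sigma>" and supp: "compact (closure {x. \<sigma> x \<noteq> 0})"
  let ?\<Phi> = "\<lambda>x. ln (\<rho> x / \<pi> x) + 1"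
  have [simp]: "\<rho> x \<noteq> 0" "\<pi> x \<noteq> 0" for x
    using pos[of x] by auto
  obtain K where K: "compact K" and \<sigma>0: "\<And>x. x \<notin> K \<Longrightarrow> \<sigma> x = 0"
    using that[OF supp] closure_subset[of "{x. \<sigma> x \<noteq> 0}"] by blast
  have c\<sigma>: "continuous_on UNIV \<sigma>"
    by (rule smooth_imp_continuous_on[OF \<sigma>])
  show int\<Phi>: "integrable lborel (\<lambda>x. ?\<Phi> x * \<sigma> x)"
    by (rule integrable_compact_support[OF _ K])
      (auto intro!: continuous_intros cont c\<sigma> simp: \<sigma>0)
  have intQ: "integrable lborel (\<lambda>x. (\<sigma> x)\<^sup>2 / \<rho> x)"
    by (rule integrable_compact_support[OF _ K])
      (auto intro!: continuous_intros cont c\<sigma> simp: \<sigma>0)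
  \<comment> \<open>For \<open>\<bar>\<epsilon>\<bar> < 1 / M\<close> the factor
    \<open>1 + \<epsilon> * (\<sigma> x / \<rho> x)\<close> is positive, so the perturbed density
    stays positive everywhere.\<close>
  obtain M where M: "0 < M" "\<And>x. \<bar>\<sigma> x / \<rho> x\<bar> \<le> M"
    by (rule bounded_compact_support[OF _ K, of "\<lambda>x. \<sigma> x / \<rho> x"])
      (auto intro!: continuous_intros cont c\<sigma> simp: \<sigma>0)
  show "((\<lambda>\<epsilon>. relative_entropy \<pi> (\<lambda>x. \<rho> x + \<epsilon> * \<sigma> x)) has_real_derivative
      (\<integral>x. ?\<Phi> x * \<sigma> x \<partial>lborel)) (at 0)"
  proof (rule has_real_derivative_quadratic_remainder[where \<delta> = "1 / M" and C = "\<integral>x. (\<sigma> x)\<^sup>2 / \<rho> x \<partial>lborel"])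
    show "0 < 1 / M" using M by simp
    fix \<epsilon> :: real assume \<epsilon>: "\<bar>\<epsilon>\<bar> < 1 / M"
    have pos': "0 < \<rho> x + \<epsilon> * \<sigma> x" for x
    proof -
      have "\<bar>\<epsilon> * (\<sigma> x / \<rho> x)\<bar> \<le> \<bar>\<epsilon>\<bar> * M"
        using mult_left_mono[OF M(2)[of x] abs_ge_zero[of \<epsilon>]] by (simp add: abs_mult)
      also have "\<dots> < 1"
        using \<epsilon> M by (simp add: field_simps)
      finally have "0 < 1 + \<epsilon> * (\<sigma> x / \<rho> x)" by linarith
      then have "0 < \<rho> x * (1 + \<epsilon> * (\<sigma> x / \<rho> x))"
        using pos by simp
      then show ?thesis by (simp add: algebra_simps)
    qed
    let ?g = "\<lambda>x. (\<rho> x + \<epsilon> * \<sigma> x) * ln ((\<rho> x + \<epsilon> * \<sigma> x) / \<pi> x)"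
    let ?h = "\<lambda>x. \<rho> x * ln (\<rho> x / \<pi> x)"
    define R where "R x = ?g x - ?h x - \<epsilon> * (?\<Phi> x * \<sigma> x)" for x
    have [simp]: "\<rho> x + \<epsilon> * \<sigma> x \<noteq> 0" for x
      using pos'[of x] by simp
    \<comment> \<open>Outside \<open>K\<close> the perturbation vanishes, the two entropy integrands
      agree, and \<open>R\<close> is zero.\<close>
    have intR: "integrable lborel R"
      by (rule integrable_compact_support[OF _ K])
        (auto simp: R_def[abs_def] \<sigma>0 intro!: continuous_intros cont c\<sigma>)
    \<comment> \<open>The remainder bounds with \<open>s = \<rho> x\<close> and
      \<open>t = \<rho> x + \<epsilon> * \<sigma> x\<close>, so that
      \<open>t - s = \<epsilon> * \<sigma> x\<close>.\<close>
    have R: "0 \<le> R x" "R x \<le> \<epsilon>\<^sup>2 * ((\<sigma> x)\<^sup>2 / \<rho> x)" for x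
      using entropy_remainder_bounds[OF pos(1)[of x] pos'[of x] pos(2)[of x]]
      by (simp_all add: R_def power_mult_distrib mult_ac)
    have "?g = (\<lambda>x. ?h x + \<epsilon> * (?\<Phi> x * \<sigma> x) + R x)"
      by (auto simp: R_def)
    then have "relative_entropy \<pi> (\<lambda>x. \<rho> x + \<epsilon> * \<sigma> x)
        = (\<integral>x. ?h x + \<epsilon> * (?\<Phi> x * \<sigma> x) + R x \<partial>lborel)"
      by (simp add: relative_entropy_def)
    also have "\<dots> = relative_entropy \<pi> \<rho> + \<epsilon> * (\<integral>x. ?\<Phi> x * \<sigma> x \<partial>lborel) + (\<integral>x. R x \<partial>lborel)"
      using fin int\<Phi> intR by (simp add: relative_entropy_def)
    finally have "relative_entropy \<pi> (\<lambda>x. \<rho> x + \<epsilon> * \<sigma> x) - relative_entropy \<pi> (\<lambda>x. \<rho> x + 0 * \<sigma> x)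
        - \<epsilon> * (\<integral>x. ?\<Phi> x * \<sigma> x \<partial>lborel) = (\<integral>x. R x \<partial>lborel)"
      by simp
    moreover have "\<bar>\<integral>x. R x \<partial>lborel\<bar> \<le> \<epsilon>\<^sup>2 * (\<integral>x. (\<sigma> x)\<^sup>2 / \<rho> x \<partial>lborel)"
      by (subst integral_mult_right_zero[symmetric], rule integral_abs_bound_integral[OF intR integrable_mult_right[OF intQ]]) (use R in simp)
    ultimately show "\<bar>relative_entropy \<pi> (\<lambda>x. \<rho> x + \<epsilon> * \<sigma> x) - relative_entropy \<pi> (\<lambda>x. \<rho> x + 0 * \<sigma> x)
        - \<epsilon> * (\<integral>x. ?\<Phi> x * \<sigma> x \<partial>lborel)\<bar> \<le> \<epsilon>\<^sup>2 * (\<integral>x. (\<sigma> x)\<^sup>2 / \<rho> x \<partial>lborel)"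
      by simp
  qed
qed

subsection \<open>Integration by parts\<close>

lemma divergence_scaleR:
  assumes "g differentiable (at x)" "F differentiable (at x)"
  shows "divergence (\<lambda>y. g y *\<^sub>R F y) x = grad g x \<bullet> F x + g x * divergence F x"
  using assms
  by (simp add: divergence_def partial_mult differentiable_vec_nth grad_def inner_vec_def
      sum.distrib sum_distrib_left)

text \<open>The last hypothesis holds for \<open>f = ln (\<rho> / \<pi>) + 1\<close>. It splits the
  product rule term \<open>grad \<rho> x\<close> into a part giving \<open>Gamma1\<close> and a part
  giving the drift of \<open>generator\<close>.\<close>

lemma divergence_weighted_flux:
  assumes "\<rho> differentiable (at x)" "a differentiable (at x)" "grad f differentiable (at x)"
    and "grad \<rho> x = \<rho> x *\<^sub>R (grad f x + grad (\<lambda>y. ln (\<pi> y)) x)"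
  shows "divergence (\<lambda>y. \<rho> y *\<^sub>R (mat_sq a y *v grad f y)) x
    = \<rho> x * (generator a \<pi> f x + Gamma1 a f f x)"
proof -
  have "(\<lambda>y. mat_sq a y *v grad f y) differentiable (at x)"
    by (intro differentiable_bounded_bilinear[OF bounded_bilinear_matrix_vector_mult]
        differentiable_mat_sq assms)
  then show ?thesis
    by (simp add: divergence_scaleR assms generator_def Gamma1_mat_sq inner_add_left algebra_simps)
qed

lemma inner_mat_sq_commute: "v \<bullet> (mat_sq a x *v w) = w \<bullet> (mat_sq a x *v v)"
  by (simp add: inner_mat_sq inner_commute)

text \<open>Differentiating the matrix gives \<open>grad_mat_grad\<close>. Differentiating either
  copy of the gradient gives the same term, since \<open>mat_sq\<close> is symmetric; hence the
  factor 2.\<close>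

lemma partial_Gamma1:
  assumes "a differentiable (at x)" "grad f differentiable (at x)"
  shows "partial p (Gamma1 a f f) x
    = grad_mat_grad (mat_sq a) f x $ p + 2 * (partial p (grad f) x \<bullet> (mat_sq a x *v grad f x))"
proof -
  have A: "mat_sq a differentiable (at x)"
    by (rule differentiable_mat_sq[OF assms(1)])
  note Af = differentiable_bounded_bilinear[OF bounded_bilinear_matrix_vector_mult A assms(2)]
  have "partial p (Gamma1 a f f) x = partial p (\<lambda>y. grad f y \<bullet> (mat_sq a y *v grad f y)) x"
    by (simp add: Gamma1_mat_sq[abs_def])
  also have "\<dots> = grad f x \<bullet> (mat_sq a x *v partial p (grad f) x + partial p (mat_sq a) x *v grad f x)
      + partial p (grad f) x \<bullet> (mat_sq a x *v grad f x)"
    by (simp add: partial_bounded_bilinear[OF bounded_bilinear_inner assms(2) Af]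
        partial_bounded_bilinear[OF bounded_bilinear_matrix_vector_mult A assms(2)])
  also have "\<dots> = grad f x \<bullet> (partial p (mat_sq a) x *v grad f x)
      + 2 * (partial p (grad f) x \<bullet> (mat_sq a x *v grad f x))"
    by (simp add: inner_add_right inner_mat_sq inner_commute)
  finally show ?thesis
    by (simp add: grad_mat_grad_def)
qed

text \<open>The two Hessian contributions \<open>2 (A\<nabla>f)\<^sup>T Hess f (Z\<nabla>f)\<close> coincide and cancel.\<close>

lemma grad_Gamma1_diff:
  assumes "a differentiable (at x)" "z differentiable (at x)" "grad f differentiable (at x)"
    and sym: "\<And>p q. partial p (grad f) x $ q = partial q (grad f) x $ p"
  shows "grad (Gamma1 a f f) x \<bullet> (mat_sq z x *v grad f x)
      - grad (Gamma1 z f f) x \<bullet> (mat_sq a x *v grad f x)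
    = grad_mat_grad (mat_sq a) f x \<bullet> (mat_sq z x *v grad f x)
      - grad_mat_grad (mat_sq z) f x \<bullet> (mat_sq a x *v grad f x)"
proof -
  let ?v = "mat_sq a x *v grad f x" and ?w = "mat_sq z x *v grad f x"
  \<comment> \<open>Exchanging the order of summation transposes the Hessian, and \<open>sym\<close>
    undoes the transposition.\<close>
  have hess: "(\<Sum>p\<in>UNIV. (partial p (grad f) x \<bullet> ?v) * ?w $ p)
      = (\<Sum>p\<in>UNIV. (partial p (grad f) x \<bullet> ?w) * ?v $ p)"
    unfolding inner_vec_def sum_distrib_right
    by (subst sum.swap) (intro sum.cong refl; subst sym; simp)
  have "grad (Gamma1 a f f) x \<bullet> ?w = grad_mat_grad (mat_sq a) f x \<bullet> ?w
      + 2 * (\<Sum>p\<in>UNIV. (partial p (grad f) x \<bullet> ?v) * ?w $ p)"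
    by (simp add: inner_vec_def[of _ ?w] grad_def[of "Gamma1 a f f"] partial_Gamma1 assms(1,3)
        sum.distrib sum_distrib_left distrib_left distrib_right mult_ac)
  moreover have "grad (Gamma1 z f f) x \<bullet> ?v = grad_mat_grad (mat_sq z) f x \<bullet> ?v
      + 2 * (\<Sum>p\<in>UNIV. (partial p (grad f) x \<bullet> ?w) * ?v $ p)"
    by (simp add: inner_vec_def[of _ ?v] grad_def[of "Gamma1 z f f"] partial_Gamma1 assms(2,3)
        sum.distrib sum_distrib_left distrib_left distrib_right mult_ac)
  ultimately show ?thesis
    by (simp add: hess)
qed

section \<open>Gradients of logarithms and of ratios of densities\<close>

lemma grad_ln:
  assumes "f differentiable (at x)" "0 < f x"
  shows "grad (\<lambda>y. ln (f y)) x = grad f x /\<^sub>R f x"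
  using assms by (simp add: grad_def partial_ln vec_eq_iff divide_inverse)

text \<open>The components are the quotients \<open>partial i f y / f y\<close>. By the quotient
  rule, symmetry of the second derivatives reduces to \<open>partial_commute\<close>.\<close>

lemma grad_ln_smooth:
  assumes f: "smooth f" "\<And>x. 0 < f x"
  shows "grad (\<lambda>y. ln (f y)) differentiable (at x)"
    and "partial p (grad (\<lambda>y. ln (f y))) x $ q = partial q (grad (\<lambda>y. ln (f y))) x $ p"
proof -
  have [simp]: "f y \<noteq> 0" for y using f(2)[of y] by simp
  note diff = smooth_imp_differentiable[OF f(1)] smooth_imp_differentiable[OF smooth_partial[OF f(1)]]
  have g: "grad (\<lambda>y. ln (f y)) y $ i = partial i f y / f y" for y i
    by (simp add: grad_def partial_ln diff f)
  show D: "grad (\<lambda>y. ln (f y)) differentiable (at x)"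
    by (rule differentiable_vec_lambda) (simp add: g diff)
  show "partial p (grad (\<lambda>y. ln (f y))) x $ q = partial q (grad (\<lambda>y. ln (f y))) x $ p"
    by (simp add: partial_vec_nth[OF D, symmetric] g partial_divide diff partial_commute[OF f(1), of p q])
qed

lemma grad_log_ratio:
  assumes \<rho>: "smooth \<rho>" "\<And>x. 0 < \<rho> x" and \<pi>: "smooth \<pi>" "\<And>x. 0 < \<pi> x"
  shows "grad (\<lambda>x. ln (\<rho> x / \<pi> x) + c)
    = (\<lambda>x. grad (\<lambda>y. ln (\<rho> y)) x - grad (\<lambda>y. ln (\<pi> y)) x)"
proof -
  have "(\<lambda>x. ln (\<rho> x / \<pi> x) + c) = (\<lambda>x. ln (\<rho> x) - ln (\<pi> x) + c)"
    using \<rho> \<pi> by (simp add: fun_eq_iff ln_div less_imp_neq[symmetric])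
  then show ?thesis
    using \<rho> \<pi> by (simp add: grad_def fun_eq_iff vec_eq_iff partial_add_const partial_diff
        differentiable_ln smooth_imp_differentiable)
qed

text \<open>The logarithmic derivative of the ratio. Multiplied by \<open>\<pi>\<close>, it turns
  the gradient of the weight \<open>\<rho> / \<pi>\<close> into \<open>\<rho>\<close> times the
  gradient of \<open>f\<close>.\<close>

lemma grad_ratio:
  assumes "\<rho> differentiable (at x)" "\<pi> differentiable (at x)" "0 < \<rho> x" "0 < \<pi> x"
  shows "grad (\<lambda>x. \<rho> x / \<pi> x) x
    = (\<rho> x / \<pi> x) *\<^sub>R (grad (\<lambda>y. ln (\<rho> y)) x - grad (\<lambda>y. ln (\<pi> y)) x)"
  using assms by (simp add: grad_def vec_eq_iff partial_divide partial_ln field_simps)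

section \<open>The integral identity\<close>

lemma integral_Gamma2_tilde_eq:
  fixes a :: "real^'d \<Rightarrow> real^'k^'d" and z :: "real^'d \<Rightarrow> real^'l^'d"
    and \<pi> \<rho> f :: "real^'d \<Rightarrow> real"
  assumes a: "smooth a" and z: "smooth z"
    and \<pi>: "smooth \<pi>" "\<And>x. 0 < \<pi> x" and \<rho>: "smooth \<rho>" "\<And>x. 0 < \<rho> x"
    and f: "f = (\<lambda>x. ln (\<rho> x / \<pi> x) + 1)"
    and integrable: "integrable lborel (\<lambda>x. Gamma2_tilde a z \<pi> f x * \<rho> x)"
      "integrable lborel (\<lambda>x. Gamma2_z_pi a z \<pi> f x * \<rho> x)"
    and ibp: "integrates_by_parts (generator z \<pi> f) (\<lambda>x. \<rho> x *\<^sub>R (mat_sq a x *v grad f x))"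
      "integrates_by_parts (generator a \<pi> f) (\<lambda>x. \<rho> x *\<^sub>R (mat_sq z x *v grad f x))"
      "integrates_by_parts (Gamma1 a f f) (\<lambda>x. \<rho> x *\<^sub>R (mat_sq z x *v grad f x))"
      "integrates_by_parts (Gamma1 z f f) (\<lambda>x. \<rho> x *\<^sub>R (mat_sq a x *v grad f x))"
      "integrates_by_parts (\<lambda>x. \<rho> x / \<pi> x) (\<lambda>x. \<pi> x *\<^sub>R (mat_sq z x *v grad_mat_grad (mat_sq a) f x))"
      "integrates_by_parts (\<lambda>x. \<rho> x / \<pi> x) (\<lambda>x. \<pi> x *\<^sub>R (mat_sq a x *v grad_mat_grad (mat_sq z) f x))"
  shows "(\<integral>x. Gamma2_tilde a z \<pi> f x * \<rho> x \<partial>lborel) = (\<integral>x. Gamma2_z_pi a z \<pi> f x * \<rho> x \<partial>lborel)"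
proof -
  note diff = smooth_imp_differentiable[OF a] smooth_imp_differentiable[OF z]
    smooth_imp_differentiable[OF \<rho>(1)] smooth_imp_differentiable[OF \<pi>(1)]
  note grad_f = grad_log_ratio[OF \<rho> \<pi>, of 1, folded f]
  have Df: "grad f differentiable (at x)" for x
    unfolding grad_f by (intro derivative_intros grad_ln_smooth \<rho> \<pi>)
  have sym: "partial p (grad f) x $ q = partial q (grad f) x $ p" for p q x
    unfolding grad_f by (simp add: partial_diff grad_ln_smooth(1) \<rho> \<pi>
        grad_ln_smooth(2)[OF \<rho>, of p x q] grad_ln_smooth(2)[OF \<pi>, of p x q])
  have "\<rho> x \<noteq> 0" for x using \<rho>(2)[of x] by simp
  then have "grad \<rho> x = \<rho> x *\<^sub>R (grad f x + grad (\<lambda>y. ln (\<pi> y)) x)" for x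
    by (simp add: grad_f grad_ln diff \<rho>)
  note flux = divergence_weighted_flux[OF _ _ Df this]
  \<comment> \<open>For each of the six integrations by parts, \<open>E\<close> is the gradient side
    and \<open>D\<close> the divergence side; their integrals are opposite.\<close>
  define E1 D1 E2 D2 E3 D3 E4 D4 E5 D5 E6 D6 where EDs:
    "E1 = (\<lambda>x. grad (generator z \<pi> f) x \<bullet> (\<rho> x *\<^sub>R (mat_sq a x *v grad f x)))"
    "D1 = (\<lambda>x. generator z \<pi> f x * divergence (\<lambda>x. \<rho> x *\<^sub>R (mat_sq a x *v grad f x)) x)"
    "E2 = (\<lambda>x. grad (generator a \<pi> f) x \<bullet> (\<rho> x *\<^sub>R (mat_sq z x *v grad f x)))"
    "D2 = (\<lambda>x. generator a \<pi> f x * divergence (\<lambda>x. \<rho> x *\<^sub>R (mat_sq z x *v grad f x)) x)"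
    "E3 = (\<lambda>x. grad (Gamma1 a f f) x \<bullet> (\<rho> x *\<^sub>R (mat_sq z x *v grad f x)))"
    "D3 = (\<lambda>x. Gamma1 a f f x * divergence (\<lambda>x. \<rho> x *\<^sub>R (mat_sq z x *v grad f x)) x)"
    "E4 = (\<lambda>x. grad (Gamma1 z f f) x \<bullet> (\<rho> x *\<^sub>R (mat_sq a x *v grad f x)))"
    "D4 = (\<lambda>x. Gamma1 z f f x * divergence (\<lambda>x. \<rho> x *\<^sub>R (mat_sq a x *v grad f x)) x)"
    "E5 = (\<lambda>x. grad (\<lambda>x. \<rho> x / \<pi> x) x \<bullet> (\<pi> x *\<^sub>R (mat_sq z x *v grad_mat_grad (mat_sq a) f x)))"
    "D5 = (\<lambda>x. \<rho> x / \<pi> x * divergence (\<lambda>x. \<pi> x *\<^sub>R (mat_sq z x *v grad_mat_grad (mat_sq a) f x)) x)"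
    "E6 = (\<lambda>x. grad (\<lambda>x. \<rho> x / \<pi> x) x \<bullet> (\<pi> x *\<^sub>R (mat_sq a x *v grad_mat_grad (mat_sq z) f x)))"
    "D6 = (\<lambda>x. \<rho> x / \<pi> x * divergence (\<lambda>x. \<pi> x *\<^sub>R (mat_sq a x *v grad_mat_grad (mat_sq z) f x)) x)"
  note parts = ibp[unfolded integrates_by_parts_def, folded EDs]
  have ints [simp]: "integrable lborel E1" "integrable lborel D1" "integrable lborel E2" "integrable lborel D2"
      "integrable lborel E3" "integrable lborel D3" "integrable lborel E4" "integrable lborel D4"
      "integrable lborel E5" "integrable lborel D5" "integrable lborel E6" "integrable lborel D6"
    using parts by auto
  \<comment> \<open>The common term with \<open>generator a \<pi> (Gamma1 z f f)\<close>
    cancels.\<close>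
  have "Gamma2_tilde a z \<pi> f x * \<rho> x - Gamma2_z_pi a z \<pi> f x * \<rho> x
      = E2 x - E1 x - D5 x + D6 x" for x
    by (simp add: Gamma2_tilde_def Gamma2_z_pi_def EDs Gamma1_mat_sq algebra_simps)
  then have "(\<integral>x. Gamma2_tilde a z \<pi> f x * \<rho> x \<partial>lborel) - (\<integral>x. Gamma2_z_pi a z \<pi> f x * \<rho> x \<partial>lborel)
      = (\<integral>x. E2 x - E1 x - D5 x + D6 x \<partial>lborel)"
    by (simp add: integrable flip: Bochner_Integration.integral_diff)
  also have "\<dots> = integral\<^sup>L lborel E2 - integral\<^sup>L lborel E1 - integral\<^sup>L lborel D5 + integral\<^sup>L lborel D6"
    by simp
  finally have total: "(\<integral>x. Gamma2_tilde a z \<pi> f x * \<rho> x \<partial>lborel) - (\<integral>x. Gamma2_z_pi a z \<pi> f x * \<rho> x \<partial>lborel)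
      = integral\<^sup>L lborel E2 - integral\<^sup>L lborel E1 - integral\<^sup>L lborel D5 + integral\<^sup>L lborel D6" .
  \<comment> \<open>By \<open>flux\<close> each divergence is \<open>\<rho>\<close> times a sum of a
    generator and a \<open>Gamma1\<close>. After expansion all products, including
    \<open>Gamma1 a f f x * Gamma1 z f f x\<close>, cancel in pairs.\<close>
  have "D1 x - D2 x - D3 x + D4 x = 0" for x
    by (simp add: EDs flux diff algebra_simps)
  then have "(\<integral>x. D1 x - D2 x - D3 x + D4 x \<partial>lborel) = 0"
    by simp
  then have D: "integral\<^sup>L lborel D1 - integral\<^sup>L lborel D2 - integral\<^sup>L lborel D3 + integral\<^sup>L lborel D4 = 0"
    by simp
  have ratio: "grad (\<lambda>x. \<rho> x / \<pi> x) x \<bullet> (\<pi> x *\<^sub>R w) = \<rho> x * (grad f x \<bullet> w)" for x w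
    using less_imp_neq[OF \<pi>(2)[of x]] by (simp add: grad_ratio diff \<rho> \<pi> grad_f)
  \<comment> \<open>The Hessian terms drop out by \<open>grad_Gamma1_diff\<close>;
    \<open>ratio\<close> and the symmetry of \<open>mat_sq\<close> identify the rest.\<close>
  have "E3 x - E4 x = E5 x - E6 x" for x
  proof -
    have "E3 x - E4 x = \<rho> x * (grad_mat_grad (mat_sq a) f x \<bullet> (mat_sq z x *v grad f x)
        - grad_mat_grad (mat_sq z) f x \<bullet> (mat_sq a x *v grad f x))"
      using grad_Gamma1_diff[OF diff(1,2) Df sym, of x] by (simp add: EDs flip: right_diff_distrib)
    also have "\<dots> = E5 x - E6 x"
      by (simp add: EDs ratio right_diff_distrib inner_mat_sq_commute[of "grad f x"] del: inner_scaleR_right)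
    finally show ?thesis .
  qed
  then have "(\<integral>x. E3 x - E4 x \<partial>lborel) = (\<integral>x. E5 x - E6 x \<partial>lborel)"
    by simp
  then have E: "integral\<^sup>L lborel E3 - integral\<^sup>L lborel E4 = integral\<^sup>L lborel E5 - integral\<^sup>L lborel E6"
    by simp
  show ?thesis
    \<comment> \<open>For the integrals, E2 - E1 = D1 - D2 = D3 - D4 = E4 - E3 = E6 - E5 = D5 - D6,
      so the right side of \<open>total\<close> vanishes.\<close>
    using total D E parts by linarith
qed

text \<open>The six integration by parts hypotheses make the absence of boundary terms explicit. The
  first conjunct confirms that the explicit \<open>\<Phi>\<close>, with its constant 1, is the first
  variation; \<open>finite_entropy\<close> makes the entropy at \<open>\<rho>\<close> a genuine
  integral.\<close>

theorem proposition4p8: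
  fixes a :: "real^('n::finite + 'm::finite) \<Rightarrow> real^'n^('n + 'm)"
    and z :: "real^('n + 'm) \<Rightarrow> real^'m^('n + 'm)"
    and \<pi> \<rho> \<Phi> :: "real^('n + 'm) \<Rightarrow> real"
  assumes smooth_a: "smooth a"
    and smooth_z: "smooth z"
    and density_\<pi>: "smooth_positive_density \<pi>"
    and hormander: "strong_hormander a"
    and density_\<rho>: "smooth_positive_density \<rho>"
    and Phi: "\<Phi> = (\<lambda>x. ln (\<rho> x / \<pi> x) + 1)"
    and finite_entropy: "integrable lborel (\<lambda>x. \<rho> x * ln (\<rho> x / \<pi> x))"
    and integrable_tilde: "integrable lborel (\<lambda>x. Gamma2_tilde a z \<pi> \<Phi> x * \<rho> x)"
    and integrable_z_pi: "integrable lborel (\<lambda>x. Gamma2_z_pi a z \<pi> \<Phi> x * \<rho> x)"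
    and ibp_gen_z: "integrates_by_parts (generator z \<pi> \<Phi>) (\<lambda>x. \<rho> x *\<^sub>R (mat_sq a x *v grad \<Phi> x))"
    and ibp_gen_a: "integrates_by_parts (generator a \<pi> \<Phi>) (\<lambda>x. \<rho> x *\<^sub>R (mat_sq z x *v grad \<Phi> x))"
    and ibp_Gamma1_a: "integrates_by_parts (Gamma1 a \<Phi> \<Phi>) (\<lambda>x. \<rho> x *\<^sub>R (mat_sq z x *v grad \<Phi> x))"
    and ibp_Gamma1_z: "integrates_by_parts (Gamma1 z \<Phi> \<Phi>) (\<lambda>x. \<rho> x *\<^sub>R (mat_sq a x *v grad \<Phi> x))"
    and ibp_div_z: "integrates_by_parts (\<lambda>x. \<rho> x / \<pi> x)
          (\<lambda>x. \<pi> x *\<^sub>R (mat_sq z x *v grad_mat_grad (mat_sq a) \<Phi> x))"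
    and ibp_div_a: "integrates_by_parts (\<lambda>x. \<rho> x / \<pi> x)
          (\<lambda>x. \<pi> x *\<^sub>R (mat_sq a x *v grad_mat_grad (mat_sq z) \<Phi> x))"
  shows "L2_first_variation (relative_entropy \<pi>) \<rho> \<Phi> \<and>
         (\<integral>x. Gamma2_tilde a z \<pi> \<Phi> x * \<rho> x \<partial>lborel)
           = (\<integral>x. Gamma2_z_pi a z \<pi> \<Phi> x * \<rho> x \<partial>lborel)"
proof -
  have \<pi>: "smooth \<pi>" "\<And>x. 0 < \<pi> x" and \<rho>: "smooth \<rho>" "\<And>x. 0 < \<rho> x"
    using density_\<pi> density_\<rho> by (auto simp: smooth_positive_density_def)
  have "L2_first_variation (relative_entropy \<pi>) \<rho> \<Phi>"
    unfolding Phi using \<pi> \<rho> finite_entropy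
    by (intro L2_first_variation_relative_entropy smooth_imp_continuous_on)
  moreover have "(\<integral>x. Gamma2_tilde a z \<pi> \<Phi> x * \<rho> x \<partial>lborel)
      = (\<integral>x. Gamma2_z_pi a z \<pi> \<Phi> x * \<rho> x \<partial>lborel)"
    by (rule integral_Gamma2_tilde_eq[OF smooth_a smooth_z \<pi> \<rho> Phi integrable_tilde integrable_z_pi
          ibp_gen_z ibp_gen_a ibp_Gamma1_a ibp_Gamma1_z ibp_div_z ibp_div_a])
  ultimately show ?thesis ..
qed

end
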